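(* If $G$ is a connected graph of girth at least $6$ and minimum degree at least $3$, then $\alpha_b(G)<2\alpha(G)$.
   Context: All graphs are finite, simple and undirected. $\alpha(G)$ is the independence number of $G$ (maximum size of a set of pairwise nonadjacent vertices). For a connected graph $G$, an independent broadcast on $G$ is a function $f:V(G)\to\{0,1,2,\dots\}$ such that (B1) $f(x)\le \mathrm{ecc}_G(x)$ for every vertex $x$, where $\mathrm{ecc}_G(x)$ is the eccentricity of $x$ in $G$, and (B2) $\mathrm{dist}_G(x,y)>\max\{f(x),f(y)\}$ for every two distinct vertices $x,y$ with $f(x),f(y)>0$. The weight of $f$ is $\sum_{x\in V(G)}f(x)$, and the broadcast independence number $\alpha_b(G)$ is the maximum weight of an independent broadcast on $G$. *)

theory Defs
  imports "Graph_Theory.Graph_Theory" "HOL-Library.Extended_Nat"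
begin

text \<open>
  A finite simple undirected graph is a symmetric loop-free relation on a finite vertex set
  (\<^locale>\<open>pair_graph\<close>): an edge between \<open>u\<close> and \<open>v\<close> is the pair of arcs
  \<open>(u, v)\<close>, \<open>(v, u)\<close>. Hence the out-degree is the degree, and a directed cycle of length at
  least 3 is an undirected cycle, whereas one of length 2 only runs back and forth along an edge.
\<close>

definition min_degree :: "'a pair_pre_digraph \<Rightarrow> nat" where
  "min_degree G = Min (out_degree (with_proj G) ` pverts G)"

text \<open>The girth of a forest is \<open>\<infinity>\<close>, the infimum of the empty set.\<close>

definition girth :: "'a pair_pre_digraph \<Rightarrow> enat" where
  "girth G = (INF p \<in> {p. pre_digraph.cycle (with_proj G) p \<and> 3 \<le> length p}. enat (length p))"

text \<open>Only meaningful if \<open>v\<close> is reachable from \<open>u\<close>; used for connected graphs only.\<close>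

definition graph_dist :: "'a pair_pre_digraph \<Rightarrow> 'a \<Rightarrow> 'a \<Rightarrow> nat" where
  "graph_dist G u v = (LEAST n. \<exists>p. pre_digraph.awalk (with_proj G) u p v \<and> length p = n)"

definition ecc :: "'a pair_pre_digraph \<Rightarrow> 'a \<Rightarrow> nat" where
  "ecc G x = Max (graph_dist G x ` pverts G)"

definition independent_set :: "'a pair_pre_digraph \<Rightarrow> 'a set \<Rightarrow> bool" where
  "independent_set G S \<longleftrightarrow> S \<subseteq> pverts G \<and> (\<forall>x\<in>S. \<forall>y\<in>S. (x, y) \<notin> parcs G)"

definition independence_number :: "'a pair_pre_digraph \<Rightarrow> nat" where
  "independence_number G = Max (card ` {S. independent_set G S})"

text \<open>Values of \<open>f\<close> outside the vertex set are irrelevant here and for the weight.\<close>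

definition independent_broadcast :: "'a pair_pre_digraph \<Rightarrow> ('a \<Rightarrow> nat) \<Rightarrow> bool" where
  "independent_broadcast G f \<longleftrightarrow>
     (\<forall>x\<in>pverts G. f x \<le> ecc G x) \<and>
     (\<forall>x\<in>pverts G. \<forall>y\<in>pverts G. x \<noteq> y \<longrightarrow> 0 < f x \<longrightarrow> 0 < f y \<longrightarrow>
        max (f x) (f y) < graph_dist G x y)"

definition broadcast_weight :: "'a pair_pre_digraph \<Rightarrow> ('a \<Rightarrow> nat) \<Rightarrow> nat" where
  "broadcast_weight G f = (\<Sum>x\<in>pverts G. f x)"

definition broadcast_independence_number :: "'a pair_pre_digraph \<Rightarrow> nat" where
  "broadcast_independence_number G = Max (broadcast_weight G ` {f. independent_broadcast G f})"

text \<open>Both maxima range over finite nonempty sets.\<close>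

lemma (in pair_graph) finite_independent_sets:
  "finite (card ` {S. independent_set G S})" "card ` {S. independent_set G S} \<noteq> {}"
proof -
  have "{S. independent_set G S} \<subseteq> Pow (pverts G)"
    by (auto simp: independent_set_def)
  then show "finite (card ` {S. independent_set G S})"
    using pair_finite_verts by (meson finite_Pow_iff finite_imageI finite_subset)
  have "independent_set G {}"
    by (simp add: independent_set_def)
  then show "card ` {S. independent_set G S} \<noteq> {}"
    by blast
qed

lemma finite_broadcast_weights:
  "finite (broadcast_weight G ` {f. independent_broadcast G f})"
  "broadcast_weight G ` {f. independent_broadcast G f} \<noteq> {}"
proof -
  have "broadcast_weight G f \<le> (\<Sum>x\<in>pverts G. ecc G x)" if "independent_broadcast G f" for f
    using that unfolding broadcast_weight_def independent_broadcast_def by (intro sum_mono) auto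
  then have "broadcast_weight G ` {f. independent_broadcast G f} \<subseteq> {..(\<Sum>x\<in>pverts G. ecc G x)}"
    by auto
  then show "finite (broadcast_weight G ` {f. independent_broadcast G f})"
    using finite_subset by blast
  have "independent_broadcast G (\<lambda>_. 0)"
    by (simp add: independent_broadcast_def)
  then show "broadcast_weight G ` {f. independent_broadcast G f} \<noteq> {}"
    by blast
qed

end

theory Submission
  imports Defs
begin

text \<open>
  Let \<open>f\<close> be an independent broadcast and give each \<open>x\<close> with \<open>f x > 0\<close> the ball of radius
  \<open>r = (f x - 1) div 2\<close> around it. Distinct such balls are disjoint and no edge joins them, so the
  union of independent sets chosen inside the balls is independent. If \<open>r = 0\<close>, the ball contributes
  \<open>x\<close> itself, and \<open>1 \<ge> f x / 2\<close>, with equality only for \<open>f x = 2\<close>. If \<open>r > 0\<close>, it contains an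
  independent set of at least \<open>r + 2 > f x / 2\<close> vertices: since there are no cycles of length 3, 4
  or 5, one can start with the neighbours of \<open>x\<close> (for odd \<open>r\<close>) or with the vertices at
  distance 2 (for even \<open>r\<close>), and then add the neighbourhoods of every second vertex of a geodesic
  starting at \<open>x\<close>. If all nonzero values are 2, replacing a single \<open>x\<close> by its
  neighbours gives strictness.
\<close>

section \<open>Neighbourhoods, degrees and reversed walks\<close>

definition nbrs :: "'a pair_pre_digraph \<Rightarrow> 'a \<Rightarrow> 'a set" where
  "nbrs G u = {v. (u, v) \<in> parcs G}"

lemma (in pair_graph) card_le_independence_number:
  assumes "independent_set G S"
  shows "card S \<le> independence_number G"
  unfolding independence_number_def
  using assms finite_independent_sets(1) by (intro Max_ge) auto

lemma (in pair_graph) parcs_sym: "(u, v) \<in> parcs G \<Longrightarrow> (v, u) \<in> parcs G"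
  by (metis arcs_symmetric)

lemma (in pair_graph) finite_nbrs: "finite (nbrs G u)"
proof -
  have "nbrs G u \<subseteq> pverts G"
    by (auto simp: nbrs_def dest: in_arcsD2)
  then show ?thesis
    using pair_finite_verts finite_subset by blast
qed

lemma (in pair_graph) card_nbrs:
  assumes "u \<in> pverts G"
  shows "min_degree G \<le> card (nbrs G u)"
proof -
  have "out_arcs (with_proj G) u = Pair u ` nbrs G u"
    by (auto simp: out_arcs_def nbrs_def)
  then have "out_degree (with_proj G) u = card (nbrs G u)"
    by (simp add: out_degree_def card_image inj_on_def)
  then show ?thesis
    unfolding min_degree_def using assms pair_finite_verts by (metis Min_le finite_imageI imageI)
qed

lemma (in pair_graph) awalk_reverse:
  assumes "awalk u p v"
  shows "\<exists>q. awalk v q u \<and> length q = length p"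
  using assms
proof (induction p arbitrary: u)
  case Nil
  then show ?case by (auto simp: awalk_simps)
next
  case (Cons e p)
  then obtain q where q: "awalk v q (snd e)" "length q = length p"
    by (auto simp: awalk_simps)
  have e: "(snd e, u) \<in> parcs G" "u \<in> pverts G"
    using Cons.prems parcs_sym[of u "snd e"] by (auto simp: awalk_simps)
  have "awalk (snd e) [(snd e, u)] u"
    using e by (simp add: awalk_simps)
  then have "awalk v (q @ [(snd e, u)]) u"
    using q awalk_appendI by blast
  then show ?case
    using q by (intro exI[of _ "q @ [(snd e, u)]"]) simp
qed

section \<open>Distances, geodesics and balls in connected graphs\<close>

locale connected_pair_graph = pair_graph +
  assumes connected: "Digraph_Component.connected (with_proj G)"
begin

lemma shortest_awalk:
  assumes "u \<in> pverts G" "v \<in> pverts G"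
  obtains p where "awalk u p v" "length p = graph_dist G u v"
proof -
  \<comment> \<open>Library connectedness means strong connectedness of the symmetric closure; the
    arc set is symmetric already.\<close>
  have "u \<rightarrow>\<^sup>*\<^bsub>with_proj G\<^esub> v"
    using connected assms reachable_mk_symmetric_eq pair_sym_arcs
    unfolding Digraph_Component.connected_def strongly_connected_def by auto
  then have "\<exists>n p. awalk u p v \<and> length p = n"
    by (simp add: reachable_awalk)
  then have "\<exists>p. awalk u p v \<and> length p = graph_dist G u v"
    unfolding graph_dist_def by (rule LeastI_ex)
  then show ?thesis
    using that by blast
qed

lemma dist_le:
  assumes "awalk u p v"
  shows "graph_dist G u v \<le> length p"
  unfolding graph_dist_def using assms by (intro Least_le) blast

lemma dist_self: "u \<in> pverts G \<Longrightarrow> graph_dist G u u = 0"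
  using dist_le[of u "[]" u] by (simp add: awalk_simps)

lemma dist_eq_0:
  assumes "u \<in> pverts G" "v \<in> pverts G" "graph_dist G u v = 0"
  shows "u = v"
  using shortest_awalk[OF assms(1,2)] assms(3) by (metis awalk_Nil_iff length_0_conv)

lemma dist_triangle:
  assumes "u \<in> pverts G" "v \<in> pverts G" "w \<in> pverts G"
  shows "graph_dist G u w \<le> graph_dist G u v + graph_dist G v w"
proof -
  obtain p q where p: "awalk u p v" "length p = graph_dist G u v"
    and q: "awalk v q w" "length q = graph_dist G v w"
    using shortest_awalk assms by metis
  show ?thesis
    using dist_le[OF awalk_appendI[OF p(1) q(1)]] p q by simp
qed

lemma dist_sym:
  assumes "u \<in> pverts G" "v \<in> pverts G"
  shows "graph_dist G u v = graph_dist G v u"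
proof -
  have "graph_dist G y x \<le> graph_dist G x y" if "x \<in> pverts G" "y \<in> pverts G" for x y
    using shortest_awalk[OF that] awalk_reverse dist_le by metis
  then show ?thesis
    using assms by (simp add: antisym)
qed

lemma dist_edge:
  assumes "(u, v) \<in> parcs G"
  shows "graph_dist G u v \<le> 1"
  using dist_le[of u "[(u, v)]" v] assms by (auto simp: awalk_simps dest: in_arcsD2)

lemma dist_step:
  assumes "x \<in> pverts G" "(u, v) \<in> parcs G"
  shows "graph_dist G x v \<le> Suc (graph_dist G x u)"
  using dist_triangle[of x u v] dist_edge[OF assms(2)] assms
  by (metis Suc_eq_plus1 add_left_mono in_arcsD1 in_arcsD2 order_trans)

text \<open>Deleting the last arc of a shortest walk leaves a shortest walk to its predecessor.
  Indexing by a function makes \<open>p i\<close> the vertex at distance \<open>i\<close>.\<close>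

lemma geodesic:
  assumes "x \<in> pverts G" "y \<in> pverts G"
  shows "\<exists>p. p (graph_dist G x y) = y \<and>
             (\<forall>i < graph_dist G x y. (p i, p (Suc i)) \<in> parcs G) \<and>
             (\<forall>i \<le> graph_dist G x y. graph_dist G x (p i) = i)"
  using assms(2)
proof (induction "graph_dist G x y" arbitrary: y)
  case 0
  then show ?case
    by (intro exI[of _ "\<lambda>_. y"]) auto
next
  case (Suc n)
  obtain w where w: "awalk x w y" "length w = Suc n"
    using shortest_awalk[OF assms(1) Suc.prems] Suc.hyps(2) by metis
  then obtain q e where qe: "w = q @ [e]" "length q = n"
    by (metis length_Suc_conv_rev)
  define z where "z = fst e"
  have z: "awalk x q z" "(z, y) \<in> parcs G"
    using w(1) qe by (auto simp: awalk_simps z_def)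
  have zV: "z \<in> pverts G"
    using z by (auto dest: in_arcsD1)
  have dz: "n = graph_dist G x z"
    using dist_le[OF z(1)] dist_step[OF assms(1) z(2)] qe Suc.hyps(2) by linarith
  obtain p where p: "p n = z" "\<forall>i < n. (p i, p (Suc i)) \<in> parcs G"
    "\<forall>i \<le> n. graph_dist G x (p i) = i"
    using Suc.hyps(1)[OF dz zV] dz by auto
  show ?case
    using p z(2) Suc.hyps(2)[symmetric]
    by (intro exI[of _ "p(Suc n := y)"]) (auto simp: less_Suc_eq le_Suc_eq)
qed

lemma ecc_geodesic:
  assumes "x \<in> pverts G"
  obtains p where "p 0 = x" "\<And>i. i < ecc G x \<Longrightarrow> (p i, p (Suc i)) \<in> parcs G"
    "\<And>i. i \<le> ecc G x \<Longrightarrow> graph_dist G x (p i) = i"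
proof -
  have "ecc G x \<in> graph_dist G x ` pverts G"
    unfolding ecc_def using assms pair_finite_verts by (intro Max_in) auto
  then obtain y where y: "y \<in> pverts G" "ecc G x = graph_dist G x y"
    by auto
  obtain p where p: "p (ecc G x) = y" "\<forall>i < ecc G x. (p i, p (Suc i)) \<in> parcs G"
     "\<forall>i \<le> ecc G x. graph_dist G x (p i) = i"
    using geodesic[OF assms y(1)] y(2) by auto
  have "p 0 \<in> pverts G"
    using p(1,2) y(1) by (cases "ecc G x") (auto dest: in_arcsD1)
  then have "p 0 = x"
    using dist_eq_0[OF assms] p(3) by force
  then show ?thesis
    using that p by blast
qed

lemma vertex_exists: "\<exists>x. x \<in> pverts G"
  using connected unfolding Digraph_Component.connected_def strongly_connected_def by auto

text \<open>With \<open>m = max (f x) (f y)\<close>, each radius is at most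
  \<open>(m - 1) / 2\<close>, so two radii and one edge add up to at most \<open>m\<close>, against
  (B2). The case \<open>u = v\<close> makes balls disjoint, an arc \<open>(u, v)\<close> excludes
  edges between them.\<close>

lemma broadcast_balls_far_apart:
  assumes f: "independent_broadcast G f"
    and x: "x \<in> pverts G" "0 < f x" "u \<in> pverts G" "graph_dist G x u \<le> (f x - 1) div 2"
    and y: "y \<in> pverts G" "0 < f y" "v \<in> pverts G" "graph_dist G y v \<le> (f y - 1) div 2"
    and uv: "graph_dist G u v \<le> 1"
  shows "x = y"
proof (rule ccontr)
  assume "x \<noteq> y"
  then have "max (f x) (f y) < graph_dist G x y"
    using f x y unfolding independent_broadcast_def by blast
  also have "\<dots> \<le> graph_dist G x u + (graph_dist G u v + graph_dist G v y)"
    using dist_triangle[of x u y] dist_triangle[of u v y] x y by linarith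
  also have "\<dots> \<le> (f x - 1) div 2 + (1 + (f y - 1) div 2)"
    using x y uv dist_sym[of v y] by linarith
  also have "\<dots> \<le> max (f x) (f y)"
    using x(2) y(2) by linarith
  finally show False
    by simp
qed

end

section \<open>Exclusion of short cycles\<close>

locale girth_6_min_degree_3 = connected_pair_graph +
  assumes girth: "6 \<le> girth G"
    and min_degree: "3 \<le> min_degree G"
begin

lemma cycle_length:
  assumes "cycle p" "3 \<le> length p"
  shows "6 \<le> length p"
proof -
  have "girth G \<le> enat (length p)"
    unfolding girth_def using assms by (intro INF_lower) auto
  then have "6 \<le> enat (length p)"
    using girth order_trans by blast
  then show ?thesis
    by (simp add: numeral_eq_enat)
qed

lemma not_self_adjacent: "(u, u) \<notin> parcs G"
  using pair_no_loops by force

lemma no_triangle: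
  assumes "(a, b) \<in> parcs G" "(b, c) \<in> parcs G" "(c, a) \<in> parcs G"
  shows False
proof -
  have "cycle [(a, b), (b, c), (c, a)]"
    unfolding cycle_def using assms not_self_adjacent
    by (intro exI[of _ a]) (auto simp: awalk_simps dest: in_arcsD1)
  then show False
    using cycle_length by fastforce
qed

text \<open>In the form used later: distinct vertices \<open>a\<close> and \<open>c\<close> have at
  most one common neighbour.\<close>

lemma no_square:
  assumes "(a, b) \<in> parcs G" "(b, c) \<in> parcs G" "(c, d) \<in> parcs G" "(d, a) \<in> parcs G" "a \<noteq> c"
  shows "b = d"
proof (rule ccontr)
  assume "b \<noteq> d"
  then have "cycle [(a, b), (b, c), (c, d), (d, a)]"
    unfolding cycle_def using assms not_self_adjacent
    by (intro exI[of _ a]) (auto simp: awalk_simps dest: in_arcsD1)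
  then show False
    using cycle_length by fastforce
qed

text \<open>This covers all closed walks of length 5: if two vertices two steps apart coincide, a
  triangle remains.\<close>

lemma no_pentagon:
  assumes "(a, b) \<in> parcs G" "(b, c) \<in> parcs G" "(c, d) \<in> parcs G" "(d, e) \<in> parcs G"
    "(e, a) \<in> parcs G"
  shows False
proof -
  have "a \<noteq> c" "b \<noteq> d" "c \<noteq> e" "d \<noteq> a" "e \<noteq> b"
    using assms no_triangle by blast+
  then have "cycle [(a, b), (b, c), (c, d), (d, e), (e, a)]"
    unfolding cycle_def using assms not_self_adjacent
    by (intro exI[of _ a]) (auto simp: awalk_simps dest: in_arcsD1)
  then show False
    using cycle_length by fastforce
qed

lemma degree: "u \<in> pverts G \<Longrightarrow> 3 \<le> card (nbrs G u)"
  using card_nbrs min_degree order_trans by blast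

lemma independent_nbrs: "independent_set G (nbrs G u)"
  unfolding independent_set_def nbrs_def using no_triangle parcs_sym in_arcsD2 by blast

section \<open>Large independent sets in balls\<close>

text \<open>Each of at least three neighbours of \<open>x\<close> contributes at least two vertices;
  an overlap would give a square, an edge a closed walk of length 5 through
  \<open>x\<close>.\<close>

lemma second_sphere:
  assumes x: "x \<in> pverts G"
  obtains I where "independent_set G I" "6 \<le> card I" "\<forall>v\<in>I. graph_dist G x v \<le> 2"
proof
  define I where "I = (\<Union>u\<in>nbrs G x. nbrs G u - {x})"
  show "independent_set G I"
    unfolding independent_set_def
  proof (intro conjI ballI notI)
    show "I \<subseteq> pverts G"
      by (auto simp: I_def nbrs_def dest: in_arcsD2)
    fix v w assume "v \<in> I" "w \<in> I" and vw: "(v, w) \<in> parcs G"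
    then obtain a b where ab: "(x, a) \<in> parcs G" "(a, v) \<in> parcs G"
      "(x, b) \<in> parcs G" "(b, w) \<in> parcs G"
      by (auto simp: I_def nbrs_def)
    show False
      using no_pentagon[OF ab(1,2) vw ab(4)[THEN parcs_sym] ab(3)[THEN parcs_sym]] .
  qed
  have two: "2 \<le> card (nbrs G u - {x})" if "u \<in> nbrs G x" for u
  proof -
    have "u \<in> pverts G"
      using that by (auto simp: nbrs_def dest: in_arcsD2)
    then show ?thesis
      using degree[of u] by (simp add: card_Diff_singleton_if) arith
  qed
  have "(nbrs G u - {x}) \<inter> (nbrs G w - {x}) = {}"
    if "u \<in> nbrs G x" "w \<in> nbrs G x" "u \<noteq> w" for u w
  proof (rule ccontr)
    assume "\<not> ?thesis"
    then obtain v where "v \<noteq> x" "(u, v) \<in> parcs G" "(w, v) \<in> parcs G"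
      by (auto simp: nbrs_def)
    then show False
      using no_square[of x u v w] that parcs_sym by (auto simp: nbrs_def)
  qed
  then have "card I = (\<Sum>u\<in>nbrs G x. card (nbrs G u - {x}))"
    unfolding I_def using finite_nbrs by (intro card_UN_disjoint) auto
  moreover have "(\<Sum>u\<in>nbrs G x. 2) \<le> (\<Sum>u\<in>nbrs G x. card (nbrs G u - {x}))"
    using two by (rule sum_mono)
  ultimately show "6 \<le> card I"
    using degree[OF x] by simp
  show "\<forall>v\<in>I. graph_dist G x v \<le> 2"
  proof
    fix v assume "v \<in> I"
    then obtain a where "(x, a) \<in> parcs G" "(a, v) \<in> parcs G"
      by (auto simp: I_def nbrs_def)
    then show "graph_dist G x v \<le> 2"
      using dist_step[OF x, of a v] dist_edge[of x a] by simp
  qed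
qed

text \<open>
  The last clause makes the induction step from \<open>r\<close> to \<open>r + 2\<close> work: a vertex of \<open>I\<close> equal or
  adjacent to a neighbour of \<open>p (r + 1)\<close> other than \<open>p r\<close> has distance at least \<open>r - 1\<close> from \<open>x\<close>.
  Being then a neighbour of \<open>p (r - 1)\<close>, it would create a cycle of length at most 5. The step
  cannot start at \<open>r = 2\<close>, where the vertices at distance 2 from \<open>x\<close> violate the clause.
\<close>

lemma independent_along_geodesic:
  assumes x: "x \<in> pverts G" and p0: "p 0 = x"
    and adj: "\<And>i. i < D \<Longrightarrow> (p i, p (Suc i)) \<in> parcs G"
    and dist: "\<And>i. i \<le> D \<Longrightarrow> graph_dist G x (p i) = i"
    and "r = 1 \<or> 3 \<le> r" "r \<le> D"
  shows "\<exists>I. independent_set G I \<and> r + 2 \<le> card I \<and> (\<forall>v\<in>I. graph_dist G x v \<le> r) \<and>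
             (\<forall>v\<in>I. r - 1 \<le> graph_dist G x v \<longrightarrow> v \<in> nbrs G (p (r - 1)))"
  using assms(5,6)
proof (induction r rule: less_induct)
  case (less r)
  consider "r = 1" | "r = 4" | "r = (r - 2) + 2" "r - 2 = 1 \<or> 3 \<le> r - 2"
    using less.prems by linarith
  then show ?case
  proof cases
    case 1
    then show ?thesis
      using independent_nbrs degree[OF x] dist_edge p0
      by (intro exI[of _ "nbrs G x"]) (auto simp: nbrs_def)
  next
    case 2
    obtain I where "independent_set G I" "6 \<le> card I" "\<forall>v\<in>I. graph_dist G x v \<le> 2"
      using second_sphere[OF x] .
    \<comment> \<open>Six is exactly \<open>r + 2\<close>, and the last clause is vacuous because
      all distances are below \<open>r - 1 = 3\<close>.\<close>
    then show ?thesis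
      using 2 by (intro exI[of _ I]) force
  next
    case 3
    then obtain s where 3: "r = s + 2" "s = 1 \<or> 3 \<le> s"
      by blast
    obtain I where I: "independent_set G I" "s + 2 \<le> card I" "\<forall>v\<in>I. graph_dist G x v \<le> s"
      "\<forall>v\<in>I. s - 1 \<le> graph_dist G x v \<longrightarrow> v \<in> nbrs G (p (s - 1))"
      using less.IH[of s] less.prems 3 by auto
    \<comment> \<open>The vertex \<open>p s\<close> is left out because \<open>I\<close> may contain
      it already; at least two neighbours remain.\<close>
    define A where "A = nbrs G (p (s + 1)) - {p s}"
    have s: "0 < s" "s + 2 \<le> D"
      using 3 less.prems by auto
    then have s1: "s + 1 \<le> D"
      by linarith
    have pe: "(p (s - 1), p s) \<in> parcs G" "(p s, p (s + 1)) \<in> parcs G"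
      using adj[of "s - 1"] adj[of s] s by auto
    have ps: "p (s + 1) \<in> pverts G"
      using pe(2) by (auto dest: in_arcsD2)
    have pne: "p (s - 1) \<noteq> p (s + 1)"
    proof
      assume "p (s - 1) = p (s + 1)"
      then have "graph_dist G x (p (s - 1)) = graph_dist G x (p (s + 1))"
        by (rule arg_cong)
      moreover have "graph_dist G x (p (s - 1)) = s - 1"
        by (rule dist) (use s in linarith)
      ultimately show False
        using dist[OF s1] by linarith
    qed
    have indA: "independent_set G A"
      using independent_nbrs[of "p (s + 1)"] by (auto simp: A_def independent_set_def)
    have cardA: "2 \<le> card A"
      using degree[OF ps] by (simp add: A_def card_Diff_singleton_if) arith
    have distA: "s \<le> graph_dist G x u \<and> graph_dist G x u \<le> s + 2" if "u \<in> A" for u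
    proof -
      have u: "(p (s + 1), u) \<in> parcs G"
        using that by (simp add: A_def nbrs_def)
      show ?thesis
        using dist_step[OF x u] dist_step[OF x parcs_sym[OF u]] dist[OF s1] by linarith
    qed
    have disj: "A \<inter> I = {}"
    proof (rule ccontr)
      assume "A \<inter> I \<noteq> {}"
      then obtain u where u: "u \<in> A" "u \<in> I"
        by auto
      then have "s - 1 \<le> graph_dist G x u"
        using distA[of u] by linarith
      then have "(p (s - 1), u) \<in> parcs G" "(p (s + 1), u) \<in> parcs G" "u \<noteq> p s"
        using I(4) u by (auto simp: A_def nbrs_def)
      \<comment> \<open>Both \<open>u\<close> and \<open>p s\<close> would be common neighbours of
        \<open>p (s - 1)\<close> and \<open>p (s + 1)\<close>.\<close>
      then show False
        using no_square[of "p (s - 1)" u "p (s + 1)" "p s"] pe pne parcs_sym by blast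
    qed
    have noedge: "(u, v) \<notin> parcs G" if "u \<in> A" "v \<in> I" for u v
    proof
      assume uv: "(u, v) \<in> parcs G"
      then have "s - 1 \<le> graph_dist G x v"
        using dist_step[OF x parcs_sym[OF uv]] distA[OF that(1)] by linarith
      then have "(p (s - 1), v) \<in> parcs G" "(p (s + 1), u) \<in> parcs G"
        using I(4) that by (auto simp: A_def nbrs_def)
      \<comment> \<open>The closed walk runs through \<open>p (s - 1)\<close>, \<open>p s\<close>,
        \<open>p (s + 1)\<close>, \<open>u\<close>, \<open>v\<close>.\<close>
      then show False
        using no_pentagon[OF pe _ uv parcs_sym] by blast
    qed
    have "independent_set G (A \<union> I)"
      using indA I(1) noedge parcs_sym unfolding independent_set_def by blast
    moreover have "r + 2 \<le> card (A \<union> I)"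
    proof -
      have "finite A" "finite I"
        using indA I(1) pair_finite_verts finite_subset unfolding independent_set_def by blast+
      then show ?thesis
        using disj cardA I(2) 3 by (simp add: card_Un_disjoint)
    qed
    moreover have "\<forall>v\<in>A \<union> I. graph_dist G x v \<le> r"
      using distA I(3) 3 by auto
    \<comment> \<open>As \<open>r - 1 = s + 1\<close>, the set \<open>I\<close> lies too close to
      \<open>x\<close> for the premise, so only \<open>A\<close> matters.\<close>
    moreover have "\<forall>v\<in>A \<union> I. r - 1 \<le> graph_dist G x v \<longrightarrow> v \<in> nbrs G (p (r - 1))"
      using I(3) 3 by (fastforce simp: A_def)
    ultimately show ?thesis
      by blast
  qed
qed

text \<open>Radius 2, left out of the induction, is handled by the vertices at distance 2.\<close>

lemma independent_in_ball:
  assumes x: "x \<in> pverts G" and r: "0 < r" "r \<le> ecc G x"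
  shows "\<exists>I. independent_set G I \<and> r + 2 \<le> card I \<and> (\<forall>v\<in>I. graph_dist G x v \<le> r)"
proof (cases "r = 2")
  case True
  obtain I where "independent_set G I" "6 \<le> card I" "\<forall>v\<in>I. graph_dist G x v \<le> 2"
    using second_sphere[OF x] .
  then show ?thesis
    using True by (intro exI[of _ I]) simp
next
  case False
  then have "r = 1 \<or> 3 \<le> r"
    using r by linarith
  moreover obtain p where "p 0 = x" "\<And>i. i < ecc G x \<Longrightarrow> (p i, p (Suc i)) \<in> parcs G"
    "\<And>i. i \<le> ecc G x \<Longrightarrow> graph_dist G x (p i) = i"
    using ecc_geodesic[OF x] by blast
  ultimately show ?thesis
    using independent_along_geodesic[OF x, of p "ecc G x" r] r by blast
qed

text \<open>Here (B1) enters: it keeps the radius within the eccentricity. Strictness is recorded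
  because one strict summand will suffice.\<close>

lemma independent_in_broadcast_ball:
  assumes x: "x \<in> pverts G" and f: "0 < f x" "f x \<le> ecc G x"
  shows "\<exists>I. independent_set G I \<and> (\<forall>v\<in>I. graph_dist G x v \<le> (f x - 1) div 2) \<and>
             f x \<le> 2 * card I \<and> (f x \<noteq> 2 \<longrightarrow> f x < 2 * card I)"
proof (cases "f x \<le> 2")
  case True
  then show ?thesis
    using x f not_self_adjacent dist_self
    by (intro exI[of _ "{x}"]) (auto simp: independent_set_def)
next
  case False
  then obtain I where "independent_set G I" "(f x - 1) div 2 + 2 \<le> card I"
    "\<forall>v\<in>I. graph_dist G x v \<le> (f x - 1) div 2"
    using independent_in_ball[OF x, of "(f x - 1) div 2"] f False by fastforce
  \<comment> \<open>Even with rounding, \<open>2 * ((f x - 1) div 2 + 2)\<close> is at least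
    \<open>f x + 2\<close>.\<close>
  moreover from this(2) have "f x < 2 * card I"
    by linarith
  ultimately show ?thesis
    by auto
qed

section \<open>Strict bounds on broadcast weights\<close>

lemma weight_all_2:
  assumes f: "independent_broadcast G f" and two: "\<forall>x\<in>pverts G. 0 < f x \<longrightarrow> f x = 2"
  shows "broadcast_weight G f < 2 * independence_number G"
proof -
  define X where "X = {x \<in> pverts G. 0 < f x}"
  have finX: "finite X"
    using pair_finite_verts by (simp add: X_def)
  have far: "2 < graph_dist G x y" if "x \<in> X" "y \<in> X" "x \<noteq> y" for x y
  proof -
    have "max (f x) (f y) < graph_dist G x y"
      using f that unfolding independent_broadcast_def X_def by blast
    then show ?thesis
      using two that by (auto simp: X_def)
  qed
  have "broadcast_weight G f = (\<Sum>x\<in>X. f x)"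
    unfolding broadcast_weight_def X_def
    using pair_finite_verts by (intro sum.mono_neutral_right) auto
  also have "\<dots> = (\<Sum>x\<in>X. 2)"
    using two by (intro sum.cong) (auto simp: X_def)
  finally have weight: "broadcast_weight G f = 2 * card X"
    by simp
  \<comment> \<open>If \<open>X\<close> is empty, any vertex serves: its neighbourhood alone is a
    nonempty independent set.\<close>
  obtain x where x: "x \<in> pverts G" "X = {} \<or> x \<in> X"
    using vertex_exists by (auto simp: X_def)
  have far_x: "2 < graph_dist G x y" if "y \<in> X - {x}" for y
    using far[of x y] that x(2) by auto
  have V: "y \<in> pverts G" if "y \<in> X" for y
    using that by (simp add: X_def)
  let ?S = "(X - {x}) \<union> nbrs G x"
  \<comment> \<open>Other members of \<open>X\<close> are at distance at least 3 from
    \<open>x\<close>, hence at least 2 from its neighbours.\<close>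
  have cross: "(u, y) \<notin> parcs G" "u \<noteq> y" if "y \<in> X - {x}" "u \<in> nbrs G x" for u y
    using far_x[OF that(1)] that(2) dist_step[OF x(1), of u y] dist_edge[of x u]
    by (auto simp: nbrs_def)
  have "independent_set G (X - {x})"
    using far dist_edge not_self_adjacent V unfolding independent_set_def
    by (metis Diff_iff not_less one_le_numeral order.trans subsetI)
  then have "independent_set G ?S"
    using independent_nbrs[of x] cross parcs_sym unfolding independent_set_def by blast
  then have "card ?S \<le> independence_number G"
    by (rule card_le_independence_number)
  moreover have "card ?S = card (X - {x}) + card (nbrs G x)"
    using finX finite_nbrs cross(2) by (intro card_Un_disjoint) auto
  moreover have "card X \<le> card (X - {x}) + 1"
    by (simp add: card_Diff_singleton_if) arith
  ultimately show ?thesis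
    using weight degree[OF x(1)] by linarith
qed

lemma broadcast_weight_less:
  assumes f: "independent_broadcast G f"
  shows "broadcast_weight G f < 2 * independence_number G"
proof (cases "\<forall>x\<in>pverts G. 0 < f x \<longrightarrow> f x = 2")
  case True
  then show ?thesis
    using weight_all_2 f by blast
next
  case False
  define X where "X = {x \<in> pverts G. 0 < f x}"
  have finX: "finite X"
    using pair_finite_verts by (simp add: X_def)
  have "\<forall>x\<in>X. \<exists>I. independent_set G I \<and> (\<forall>v\<in>I. graph_dist G x v \<le> (f x - 1) div 2) \<and>
             f x \<le> 2 * card I \<and> (f x \<noteq> 2 \<longrightarrow> f x < 2 * card I)"
    using independent_in_broadcast_ball f by (auto simp: X_def independent_broadcast_def)
  then obtain I where ind: "\<And>x. x \<in> X \<Longrightarrow> independent_set G (I x)"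
    and ball: "\<And>x v. x \<in> X \<Longrightarrow> v \<in> I x \<Longrightarrow> graph_dist G x v \<le> (f x - 1) div 2"
    and le: "\<And>x. x \<in> X \<Longrightarrow> f x \<le> 2 * card (I x)"
    and less: "\<And>x. x \<in> X \<Longrightarrow> f x \<noteq> 2 \<Longrightarrow> f x < 2 * card (I x)"
    by metis
  have sub: "I x \<subseteq> pverts G" if "x \<in> X" for x
    using ind[OF that] by (simp add: independent_set_def)
  have same: "x = y" if "x \<in> X" "y \<in> X" "u \<in> I x" "v \<in> I y" "graph_dist G u v \<le> 1" for x y u v
    using broadcast_balls_far_apart[OF f, of x u y v] that ball sub by (auto simp: X_def)
  have "independent_set G (\<Union>x\<in>X. I x)"
    unfolding independent_set_def
  proof (intro conjI ballI notI)
    show "(\<Union>x\<in>X. I x) \<subseteq> pverts G"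
      using sub by blast
    fix u v assume "u \<in> (\<Union>x\<in>X. I x)" "v \<in> (\<Union>x\<in>X. I x)" and uv: "(u, v) \<in> parcs G"
    then obtain x y where xy: "x \<in> X" "y \<in> X" "u \<in> I x" "v \<in> I y"
      by blast
    then have "x = y"
      using same dist_edge[OF uv] by blast
    then show False
      using ind[OF xy(1)] xy uv by (auto simp: independent_set_def)
  qed
  then have "card (\<Union>x\<in>X. I x) \<le> independence_number G"
    by (rule card_le_independence_number)
  moreover have "card (\<Union>x\<in>X. I x) = (\<Sum>x\<in>X. card (I x))"
  proof (rule card_UN_disjoint[OF finX])
    show "\<forall>x\<in>X. finite (I x)"
      using sub pair_finite_verts finite_subset by blast
    \<comment> \<open>A common vertex is the case of distance 0 in \<open>same\<close>.\<close>
    show "\<forall>x\<in>X. \<forall>y\<in>X. x \<noteq> y \<longrightarrow> I x \<inter> I y = {}"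
      using same dist_self sub by fastforce
  qed
  moreover have "broadcast_weight G f = (\<Sum>x\<in>X. f x)"
    unfolding broadcast_weight_def X_def
    using pair_finite_verts by (intro sum.mono_neutral_right) auto
  \<comment> \<open>Some positive value differs from 2 in this case, which makes one summand
    strict.\<close>
  moreover have "(\<Sum>x\<in>X. f x) < (\<Sum>x\<in>X. 2 * card (I x))"
    using finX le less False by (intro sum_strict_mono_ex1) (auto simp: X_def)
  ultimately show ?thesis
    by (simp add: sum_distrib_left[symmetric])
qed

end

theorem theorem1:
  fixes G :: "'a pair_pre_digraph"
  assumes "pair_graph G"
    and "Digraph_Component.connected (with_proj G)"
    and "girth G \<ge> 6"
    and "min_degree G \<ge> 3"
  shows "broadcast_independence_number G < 2 * independence_number G"
proof -
  interpret pair_graph G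
    by fact
  interpret girth_6_min_degree_3 G
    by unfold_locales (use assms in auto)
  have "broadcast_independence_number G \<in> broadcast_weight G ` {f. independent_broadcast G f}"
    unfolding broadcast_independence_number_def using finite_broadcast_weights by (rule Max_in)
  then show ?thesis
    using broadcast_weight_less by auto
qed

end
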